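(* For $t \in \mathbb{Z}_{>0}$ define $$a_1(t) = 6t^2 -13t - 216,\quad a_2(t) = 6t^2 - 125,\quad a_3(t) = 7t^2 - 174,\quad a_4(t) = t^3 - 36t - 78,$$ and $\mathbf{a}(t) = (a_1(t),a_2(t),a_3(t),a_4(t)) \in \mathbb{Z}^4$. Then there exist infinitely many positive integers $t$ such that (i) $0 < a_1(t) < a_2(t) < a_3(t) < a_4(t)$, (ii) $\gcd(a_1(t),a_2(t),a_3(t),a_4(t)) = 1$, and (iii) the lattice $\Lambda_{\mathbf{a}(t)} = \{ \mathbf{x} \in \mathbb{Z}^4 : \sum_{i=1}^4 a_i(t) x_i = 0\}$ is an ESM lattice. Moreover, for such $\mathbf{a}(t)$ (writing $a_i = a_i(t)$), the quantity $$\min\Big\{ \tfrac12\big(\sqrt{a_1a_2a_3(a_1+a_2+a_3)} - a_1-a_2-a_3\big),\ 2a_4\big[\tfrac{a_1}{4}\big] - a_1,\ 2a_3\big[\tfrac{a_4}{4}\big]-a_4,\ \big[\tfrac{(a_2-1)(a_4-2)}{2}\big]-1 \Big\}$$ is $O(t^4)$, while the quantity $$\left[ \frac{9 \sum_{i=1}^4 a_i \sqrt{ \|\mathbf{a}(t)\|^2 - a_i^2}}{(\|\mathbf{a}(t)\|^{2} \omega_{3})^{1/3}} + 1 \right]$$ is $O(t^3)$, where $\omega_3 = 4\pi/3$. In particular, all these properties hold for every $t = 13s+2$ with $s \geq 2$ an integer.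
   Context: $[x]$ denotes the integer part of $x$ and $\|\cdot\|$ the Euclidean norm. For the rank-$3$ lattice $\Lambda_{\mathbf{a}}\subset\mathbb{Z}^4$ and $1\le i\le 3$, the $i$-th successive minimum $\lambda_i$ is the infimum of all $\lambda>0$ such that the closed Euclidean ball of radius $\lambda$ about the origin in $\operatorname{span}_{\mathbb{R}}\Lambda_{\mathbf{a}}$ contains $i$ linearly independent lattice vectors; $\Lambda_{\mathbf{a}}$ is ESM (equal successive minima) if $\lambda_1=\lambda_2=\lambda_3$. The four quantities inside the minimum are previously known upper bounds on the Frobenius number (due to Beck–Diaz–Robins, Erdős–Graham, Selmer, Vitek), and the second displayed quantity is the ESM-case bound $\left[ \frac{(N-1)^2 \sum_{i} a_i \sqrt{\|\mathbf{a}\|^2-a_i^2}}{(\|\mathbf{a}\|^{N-2}\omega_{N-1})^{1/(N-1)}}+1\right]$ with $N=4$, $\omega_{N-1}$ the volume of the $(N-1)$-dimensional unit ball. *)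

theory Defs
  imports "HOL-Analysis.Analysis" "HOL-Library.Landau_Symbols"
begin

definition real_vec :: "int ^ 'n \<Rightarrow> real ^ 'n" where
  "real_vec a = (\<chi> i. real_of_int (a $ i))"

(* The lattice of integer vectors orthogonal to a, as a subset of the ambient Euclidean space. *)
definition orth_lattice :: "int ^ 'n \<Rightarrow> (real ^ 'n) set" where
  "orth_lattice a =
     {x. (\<forall>i. x $ i \<in> \<int>) \<and> (\<Sum>i\<in>UNIV. real_of_int (a $ i) * x $ i) = 0}"

(* The infimum is over a nonempty set exactly when i \<le> dim L; for larger i the value
   is unspecified. *)
definition succ_min :: "'a::euclidean_space set \<Rightarrow> nat \<Rightarrow> real" where
  "succ_min L i =
     Inf {r. r > 0 \<and>
             (\<exists>B. B \<subseteq> L \<inter> (cball 0 r \<inter> span L) \<and> finite B \<and> card B = i \<and> independent B)}"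

(* Equal successive minima, for a lattice L of rank 3. *)
definition ESM3 :: "'a::euclidean_space set \<Rightarrow> bool" where
  "ESM3 L \<longleftrightarrow> succ_min L 1 = succ_min L 2 \<and> succ_min L 2 = succ_min L 3"

definition a1 :: "int \<Rightarrow> int" where "a1 t = 6 * t^2 - 13 * t - 216"
definition a2 :: "int \<Rightarrow> int" where "a2 t = 6 * t^2 - 125"
definition a3 :: "int \<Rightarrow> int" where "a3 t = 7 * t^2 - 174"
definition a4 :: "int \<Rightarrow> int" where "a4 t = t^3 - 36 * t - 78"

definition avec :: "int \<Rightarrow> int ^ 4" where
  "avec t = vector [a1 t, a2 t, a3 t, a4 t]"

(* The smallest of four upper bounds for the Frobenius number of a1, ..., a4, due (in this
   order) to Beck--Diaz--Robins, Selmer, Erdos--Graham and Vitek. *)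
definition known_bound :: "int \<Rightarrow> real" where
  "known_bound t =
     (let b1 = real_of_int (a1 t); b2 = real_of_int (a2 t);
          b3 = real_of_int (a3 t); b4 = real_of_int (a4 t)
      in Min {1/2 * (sqrt (b1 * b2 * b3 * (b1 + b2 + b3)) - b1 - b2 - b3),
              2 * b4 * real_of_int \<lfloor>b1 / 4\<rfloor> - b1,
              2 * b3 * real_of_int \<lfloor>b4 / 4\<rfloor> - b4,
              real_of_int \<lfloor>(b2 - 1) * (b4 - 2) / 2\<rfloor> - 1})"

(* 4 * pi / 3 is the volume of the unit ball in dimension 3, see unit_ball_vol_3. *)
definition esm_bound :: "int \<Rightarrow> real" where
  "esm_bound t =
     real_of_int \<lfloor>9 * (\<Sum>i\<in>UNIV. real_of_int (avec t $ i) *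
                           sqrt ((norm (real_vec (avec t)))\<^sup>2 - (real_of_int (avec t $ i))\<^sup>2))
                   / ((norm (real_vec (avec t)))\<^sup>2 * (4 * pi / 3)) powr (1 / 3) + 1\<rfloor>"

end

theory Submission
  imports Defs "HOL-Computational_Algebra.Primes"
begin

text \<open>For \<open>28 \<le> t\<close> and coprime \<open>a2 t\<close>, \<open>a3 t\<close>, the vectors \<open>(t, -6, 7, -6)\<close>, \<open>(-6, 6, -t, 7)\<close>,
  \<open>(-7, -t, 6, 6)\<close> form a lattice basis. They have the same squared norm \<open>t\<^sup>2 + 121\<close>, and their inner
  products \<open>- (13 * t + 78)\<close>, \<open>6 - t\<close>, \<open>84 - 12 * t\<close> are so small in comparison that no nonzero
  integer combination is shorter; hence all successive minima equal \<open>sqrt (t\<^sup>2 + 121)\<close>.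
  Coprimality for \<open>t = 13 * s + 2\<close> follows from \<open>7 * a2 t - 6 * a3 t = 13\<^sup>2\<close>, as \<open>a2 t\<close> is then
  congruent to 3 modulo 13. The ESM bound has order \<open>t ^ 3\<close> because the dominant entry
  \<open>a4 t\<close>, of order \<open>t ^ 3\<close>, is paired with a square root of order \<open>t\<^sup>2\<close> only.\<close>

section \<open>General bounds on ternary forms and successive minima\<close>

text \<open>Write \<open>X\<close>, \<open>Y\<close>, \<open>Z\<close> for the absolute values and
  \<open>m\<close> for \<open>max X Y\<close>. The hypotheses bound the mixed terms by
  \<open>n * (X * Y + m * Z)\<close>, and what remains is \<open>n\<close> times a positive definite
  integral form, which is at least 1 at a nonzero point.\<close>

lemma ternary_form_ge:
  fixes n A B C x y z :: int
  assumes A: "2 * A \<le> n" and BC: "2 * (B + C) \<le> n" "0 \<le> B" "0 \<le> C"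
    and n: "0 \<le> n" and nz: "x \<noteq> 0 \<or> y \<noteq> 0 \<or> z \<noteq> 0"
  shows "n \<le> n * (x\<^sup>2 + y\<^sup>2 + z\<^sup>2) - 2 * A * \<bar>x * y\<bar> - 2 * B * \<bar>x * z\<bar> - 2 * C * \<bar>y * z\<bar>"
proof -
  define X Y Z where "X = \<bar>x\<bar>" and "Y = \<bar>y\<bar>" and "Z = \<bar>z\<bar>"
  note defs = X_def Y_def Z_def
  define m where "m = max X Y"
  have 1: "2 * A * (X * Y) \<le> n * (X * Y)"
    by (intro mult_right_mono A) (simp add: defs)
  have "B * (X * Z) + C * (Y * Z) \<le> B * (m * Z) + C * (m * Z)"
    using BC by (intro add_mono mult_left_mono mult_right_mono) (auto simp: m_def defs)
  then have "2 * B * (X * Z) + 2 * C * (Y * Z) \<le> 2 * (B + C) * (m * Z)"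
    by (simp add: algebra_simps)
  also have "\<dots> \<le> n * (m * Z)"
    by (intro mult_right_mono BC) (simp add: defs m_def)
  finally have 2: "2 * B * (X * Z) + 2 * C * (Y * Z) \<le> n * (m * Z)" .
  have pos: "X > 0 \<or> Y > 0 \<or> Z > 0" "X \<ge> 0" "Y \<ge> 0" "Z \<ge> 0" using nz by (auto simp: defs)
  \<comment> \<open>With \<open>P\<close> the larger of \<open>X\<close> and \<open>Y\<close>,
    \<open>Q\<close> the smaller and \<open>R = Z\<close>, this sum of squares is
    \<open>4 * (X\<^sup>2 + Y\<^sup>2 + Z\<^sup>2 - X * Y - m * Z)\<close>.\<close>
  have sq: "0 < 2 * P\<^sup>2 + (P - 2 * Q)\<^sup>2 + (P - 2 * R)\<^sup>2" if "P > 0 \<or> Q > 0 \<or> R > 0" for P Q R :: int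
  proof (cases "P = 0")
    case True
    then show ?thesis using that by (auto simp: add_pos_nonneg add_nonneg_pos)
  next
    case False
    then show ?thesis by (simp add: add_pos_nonneg)
  qed
  have "0 < 4 * (X\<^sup>2 + Y\<^sup>2 + Z\<^sup>2 - X * Y - m * Z)"
  proof (cases "Y \<le> X")
    case True
    then show ?thesis using sq[of X Y Z] pos
      by (simp add: m_def max_def power2_eq_square algebra_simps)
  next
    case False
    then show ?thesis using sq[of Y X Z] pos
      by (simp add: m_def max_def power2_eq_square algebra_simps)
  qed
  then have "n * 1 \<le> n * (X\<^sup>2 + Y\<^sup>2 + Z\<^sup>2 - X * Y - m * Z)"
    by (intro mult_left_mono n) simp
  also have "\<dots> = n * (X\<^sup>2 + Y\<^sup>2 + Z\<^sup>2) - n * (X * Y) - n * (m * Z)"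
    by (simp add: algebra_simps)
  also have "\<dots> \<le> n * (X\<^sup>2 + Y\<^sup>2 + Z\<^sup>2) - 2 * A * (X * Y) - 2 * B * (X * Z) - 2 * C * (Y * Z)"
    using 1 2 by linarith
  finally show ?thesis by (simp add: defs abs_mult)
qed

text \<open>An independent set omits 0, so a nonempty one inside the lattice needs radius at least
  \<open>r\<close>; any \<open>i\<close> elements of \<open>B\<close> attain \<open>r\<close>, so
  the infimum is a minimum.\<close>

lemma succ_min_eqI:
  fixes L :: "'a::euclidean_space set"
  assumes "r > 0" and min: "\<And>x. x \<in> L \<Longrightarrow> x \<noteq> 0 \<Longrightarrow> r \<le> norm x"
    and B: "B \<subseteq> L" "finite B" "independent B" "\<And>x. x \<in> B \<Longrightarrow> norm x = r"
    and i: "1 \<le> i" "i \<le> card B"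
  shows "succ_min L i = r"
  unfolding succ_min_def
proof (rule cInf_eq_minimum)
  obtain B' where B': "B' \<subseteq> B" "card B' = i"
    using obtain_subset_with_card_n[OF i(2)] by metis
  then have "B' \<subseteq> L \<inter> (cball 0 r \<inter> span L)" "finite B'" "independent B'"
    using B by (auto simp: span_base finite_subset dest: independent_mono)
  with B' \<open>r > 0\<close>
  show "r \<in> {r. r > 0 \<and> (\<exists>B. B \<subseteq> L \<inter> (cball 0 r \<inter> span L) \<and> finite B \<and> card B = i \<and> independent B)}"
    by blast
next
  fix s
  assume "s \<in> {r. r > 0 \<and> (\<exists>B. B \<subseteq> L \<inter> (cball 0 r \<inter> span L) \<and> finite B \<and> card B = i \<and> independent B)}"
  then obtain D where D: "D \<subseteq> L \<inter> (cball 0 s \<inter> span L)" "card D = i" "independent D"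
    by auto
  then obtain x where "x \<in> D" using i(1) by fastforce
  moreover from this have "x \<noteq> 0" using D(3) dependent_zero by blast
  ultimately show "r \<le> s" using D(1) min[of x] by force
qed

section \<open>The orthogonal lattice and its basis\<close>

text \<open>By Cramer's rule: \<open>a2 t\<close> and \<open>a3 t\<close> are, up to sign, maximal minors of the matrix formed
  by the three basis vectors, and a Bezout identity for them makes the coordinates integral.\<close>

lemma orth_coords:
  fixes t w x y z :: int
  assumes orth: "a1 t * w + a2 t * x + a3 t * y + a4 t * z = 0"
    and cop: "coprime (a2 t) (a3 t)"
  obtains p q r where
    "w = t * p - 6 * q - 7 * r" "x = -6 * p + 6 * q - t * r"
    "y = 7 * p - t * q + 6 * r" "z = -6 * p + 7 * q + 6 * r"
proof -
  obtain u v where uv: "u * a2 t + v * a3 t = 1"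
    using bezout_int[of "a2 t" "a3 t"] cop by (auto simp: coprime_iff_gcd_eq_1)
  define det :: "int \<Rightarrow> int \<Rightarrow> int \<Rightarrow> int \<Rightarrow> int \<Rightarrow> int \<Rightarrow> int \<Rightarrow> int \<Rightarrow> int \<Rightarrow> int"
    where "det a b c d e f g h i = a * (e * i - f * h) - b * (d * i - f * g) + c * (d * h - e * g)"
      for a b c d e f g h i
  \<comment> \<open>Cramer numerators. Dropping the second coordinate leaves the minor
    \<open>- a2 t\<close>, whence the minus signs; dropping the third leaves
    \<open>a3 t\<close>.\<close>
  define p2 where "p2 = - det w y z (-6) (-t) 7 (-7) 6 6"
  define q2 where "q2 = - det t 7 (-6) w y z (-7) 6 6"
  define r2 where "r2 = - det t 7 (-6) (-6) (-t) 7 w y z"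
  define p3 where "p3 = det w x z (-6) 6 7 (-7) (-t) 6"
  define q3 where "q3 = det t (-6) (-6) w x z (-7) (-t) 6"
  define r3 where "r3 = det t (-6) (-6) (-6) 6 7 w x z"
  note defs = p2_def q2_def r2_def p3_def q3_def r3_def det_def a1_def a2_def a3_def a4_def
  have eqs2: "a2 t * w = t * p2 - 6 * q2 - 7 * r2" "a2 t * y = 7 * p2 - t * q2 + 6 * r2"
    "a2 t * z = -6 * p2 + 7 * q2 + 6 * r2"
    unfolding defs by algebra+
  \<comment> \<open>Cramer's rule gives the three retained coordinates identically in the variables;
    the dropped one is recovered only through orthogonality.\<close>
  have "-6 * p2 + 6 * q2 - t * r2 = - (a1 t * w + a3 t * y + a4 t * z)"
    unfolding defs by algebra
  with orth have x2: "a2 t * x = -6 * p2 + 6 * q2 - t * r2" by linarith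
  have eqs3: "a3 t * w = t * p3 - 6 * q3 - 7 * r3" "a3 t * x = -6 * p3 + 6 * q3 - t * r3"
    "a3 t * z = -6 * p3 + 7 * q3 + 6 * r3"
    unfolding defs by algebra+
  have "7 * p3 - t * q3 + 6 * r3 = - (a1 t * w + a2 t * x + a4 t * z)"
    unfolding defs by algebra
  with orth have y3: "a3 t * y = 7 * p3 - t * q3 + 6 * r3" by linarith
  have comb: "c = u * (a2 t * c) + v * (a3 t * c)" for c
    using uv by algebra
  show thesis
  proof
    show "w = t * (u * p2 + v * p3) - 6 * (u * q2 + v * q3) - 7 * (u * r2 + v * r3)"
      using comb[of w] unfolding eqs2 eqs3 by (simp add: algebra_simps)
    show "x = -6 * (u * p2 + v * p3) + 6 * (u * q2 + v * q3) - t * (u * r2 + v * r3)"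
      using comb[of x] unfolding x2 eqs3 by (simp add: algebra_simps)
    show "y = 7 * (u * p2 + v * p3) - t * (u * q2 + v * q3) + 6 * (u * r2 + v * r3)"
      using comb[of y] unfolding eqs2 y3 by (simp add: algebra_simps)
    show "z = -6 * (u * p2 + v * p3) + 7 * (u * q2 + v * q3) + 6 * (u * r2 + v * r3)"
      using comb[of z] unfolding eqs2 eqs3 by (simp add: algebra_simps)
  qed
qed

lemma orth_sum_squares_ge:
  fixes t w x y z :: int
  assumes orth: "a1 t * w + a2 t * x + a3 t * y + a4 t * z = 0"
    and cop: "coprime (a2 t) (a3 t)" and t: "28 \<le> t"
    and nz: "w \<noteq> 0 \<or> x \<noteq> 0 \<or> y \<noteq> 0 \<or> z \<noteq> 0"
  shows "t\<^sup>2 + 121 \<le> w\<^sup>2 + x\<^sup>2 + y\<^sup>2 + z\<^sup>2"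
proof -
  obtain p q r where pqr: "w = t * p - 6 * q - 7 * r" "x = -6 * p + 6 * q - t * r"
    "y = 7 * p - t * q + 6 * r" "z = -6 * p + 7 * q + 6 * r"
    using orth_coords[OF orth cop] by blast
  have tt: "28 * t \<le> t\<^sup>2" using t by (simp add: power2_eq_square)
  have "t\<^sup>2 + 121 \<le> (t\<^sup>2 + 121) * (p\<^sup>2 + q\<^sup>2 + r\<^sup>2)
      - 2 * (13 * t + 78) * \<bar>p * q\<bar> - 2 * (t - 6) * \<bar>p * r\<bar> - 2 * (12 * t - 84) * \<bar>q * r\<bar>"
    \<comment> \<open>The binding condition is
      \<open>2 * (13 * t + 78) \<le> t\<^sup>2 + 121\<close>; among positive integers it holds
      exactly from 28 on.\<close>
    by (rule ternary_form_ge) (use t tt nz pqr in auto)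
  also have "\<dots> \<le> (t\<^sup>2 + 121) * (p\<^sup>2 + q\<^sup>2 + r\<^sup>2)
      - 2 * (13 * t + 78) * (p * q) - 2 * (t - 6) * (p * r) - 2 * (12 * t - 84) * (q * r)"
    using t by (intro diff_mono mult_left_mono order_refl) auto
  also have "\<dots> = w\<^sup>2 + x\<^sup>2 + y\<^sup>2 + z\<^sup>2"
    unfolding pqr by algebra
  finally show ?thesis .
qed

lemma vector_4 [simp]:
  "(vector [w, x, y, z] :: 'a::zero ^ 4) $ 1 = w"
  "(vector [w, x, y, z] :: 'a::zero ^ 4) $ 2 = x"
  "(vector [w, x, y, z] :: 'a::zero ^ 4) $ 3 = y"
  "(vector [w, x, y, z] :: 'a::zero ^ 4) $ 4 = z"
  unfolding vector_def by simp_all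

lemma norm_vec4: "(norm (v :: real ^ 4))\<^sup>2 = (v $ 1)\<^sup>2 + (v $ 2)\<^sup>2 + (v $ 3)\<^sup>2 + (v $ 4)\<^sup>2"
  by (simp add: power2_norm_eq_inner inner_vec_def sum_4 flip: power2_eq_square)

lemma ESM3_orth_lattice:
  assumes cop: "coprime (a2 t) (a3 t)" and t: "28 \<le> t"
  shows "ESM3 (orth_lattice (avec t))"
proof -
  define L where "L = orth_lattice (avec t)"
  define R where "R = real_of_int t"
  define v1 v2 v3 :: "real ^ 4"
    where v: "v1 = vector [R, -6, 7, -6]" "v2 = vector [-6, 6, -R, 7]" "v3 = vector [-7, -R, 6, 6]"
  define n where "n = R\<^sup>2 + 121"
  have R: "R \<ge> 28" using t by (simp add: R_def)
  have RR: "28 * R \<le> R\<^sup>2" using R by (simp add: power2_eq_square)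
  have n: "n > 0" by (simp add: n_def add_nonneg_pos)
  have in_L: "x \<in> L \<longleftrightarrow> (x $ 1 \<in> \<int> \<and> x $ 2 \<in> \<int> \<and> x $ 3 \<in> \<int> \<and> x $ 4 \<in> \<int>) \<and>
      a1 t * x $ 1 + a2 t * x $ 2 + a3 t * x $ 3 + a4 t * x $ 4 = 0" for x
    by (simp add: L_def orth_lattice_def avec_def forall_4 sum_4)
  have L: "{v1, v2, v3} \<subseteq> L"
    by (simp add: in_L v R_def a1_def a2_def a3_def a4_def power2_eq_square power3_eq_cube algebra_simps)
  have min: "sqrt n \<le> norm x" if x: "x \<in> L" "x \<noteq> 0" for x
  proof -
    obtain i j k l :: int where ijkl: "x $ 1 = i" "x $ 2 = j" "x $ 3 = k" "x $ 4 = l"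
      using x(1) unfolding in_L by (auto elim!: Ints_cases)
    have "i \<noteq> 0 \<or> j \<noteq> 0 \<or> k \<noteq> 0 \<or> l \<noteq> 0"
      using x(2) ijkl by (auto simp: vec_eq_iff forall_4)
    moreover have "real_of_int (a1 t * i + a2 t * j + a3 t * k + a4 t * l) = 0"
      using x(1) unfolding in_L by (simp add: ijkl)
    then have "a1 t * i + a2 t * j + a3 t * k + a4 t * l = 0" by linarith
    ultimately have "t\<^sup>2 + 121 \<le> i\<^sup>2 + j\<^sup>2 + k\<^sup>2 + l\<^sup>2"
      using orth_sum_squares_ge cop t by blast
    then have "real_of_int (t\<^sup>2 + 121) \<le> real_of_int (i\<^sup>2 + j\<^sup>2 + k\<^sup>2 + l\<^sup>2)"
      by (simp only: of_int_le_iff)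
    then have "n \<le> (norm x)\<^sup>2"
      by (simp add: n_def R_def norm_vec4 ijkl)
    then show ?thesis by (simp add: real_le_lsqrt)
  qed
  have neq: "v1 \<noteq> v2" "v1 \<noteq> v3" "v2 \<noteq> v3"
    using R by (auto simp: v vec_eq_iff forall_4)
  have ind: "independent {v1, v2, v3}"
  proof (rule independent_if_scalars_zero)
    fix f x
    assume "(\<Sum>x\<in>{v1, v2, v3}. f x *\<^sub>R x) = 0" and x: "x \<in> {v1, v2, v3}"
    then have "f v1 *\<^sub>R v1 + f v2 *\<^sub>R v2 + f v3 *\<^sub>R v3 = 0"
      using neq by (simp add: add.assoc)
    then have eq: "f v1 * R - 6 * f v2 - 7 * f v3 = 0" "7 * f v1 - R * f v2 + 6 * f v3 = 0"
      "- 6 * f v1 + 7 * f v2 + 6 * f v3 = 0"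
      by (simp_all add: v vec_eq_iff forall_4 algebra_simps)
    \<comment> \<open>Coordinates 1, 3 and 4 already decide independence: their minor is
      \<open>- a2 t\<close>, here \<open>125 - 6 * R\<^sup>2\<close>.\<close>
    have "(6 * R\<^sup>2 - 125) * f v1 = 0" "(6 * R\<^sup>2 - 125) * f v2 = 0" "(6 * R\<^sup>2 - 125) * f v3 = 0"
      using eq by algebra+
    moreover have "6 * R\<^sup>2 - 125 \<noteq> 0" using R RR by linarith
    ultimately show "f x = 0" using x by auto
  qed simp
  have norms: "norm x = sqrt n" if "x \<in> {v1, v2, v3}" for x
  proof -
    have "(norm x)\<^sup>2 = n" using that by (auto simp: norm_vec4 v n_def)
    then show ?thesis by (metis norm_ge_zero real_sqrt_unique)
  qed
  have "succ_min L i = sqrt n" if "1 \<le> i" "i \<le> 3" for i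
    by (rule succ_min_eqI[OF _ min L _ ind norms]) (use that n neq in auto)
  then show ?thesis unfolding ESM3_def L_def by simp
qed

section \<open>Coprimality and size of the entries\<close>

lemma coprime_a2_a3: "coprime (a2 (13 * s + 2)) (a3 (13 * s + 2))"
proof -
  let ?t = "13 * s + 2"
  have "a2 ?t = 3 + 13 * (78 * s\<^sup>2 + 24 * s - 8)"
    by (simp add: a2_def power2_eq_square algebra_simps)
  then have "a2 ?t mod 13 = 3" by (simp only: mod_mult_self2) simp
  moreover have "prime (13 :: int)" by simp
  ultimately have "coprime 13 (a2 ?t)"
    by (intro prime_imp_coprime) (auto simp: dvd_eq_mod_eq_0)
  then have "coprime (a2 ?t) (13 ^ 2)"
    by (metis coprime_commute coprime_power_right_iff)
  then have "coprime (a2 ?t) 169" by simp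
  moreover have "d dvd 169" if "d dvd a2 ?t" "d dvd a3 ?t" for d
  proof -
    have "169 = 7 * a2 ?t - 6 * a3 ?t" by (simp add: a2_def a3_def)
    then show ?thesis using that by (simp only: dvd_diff dvd_mult)
  qed
  ultimately show ?thesis
    unfolding coprime_def by blast
qed

text \<open>Linear arithmetic treats the powers of \<open>t\<close> as unrelated atoms; these facts
  link them. The type is general to cover both integers and reals.\<close>

lemma cubic_bounds:
  fixes t :: "'a::linordered_idom"
  assumes "28 \<le> t"
  shows "28 * t \<le> t\<^sup>2" "28 * t\<^sup>2 \<le> t ^ 3" "784 \<le> t\<^sup>2"
proof -
  show 1: "28 * t \<le> t\<^sup>2" "28 * t\<^sup>2 \<le> t ^ 3"
    using mult_right_mono[OF assms, of t] mult_right_mono[OF assms, of "t\<^sup>2"] assms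
    by (simp_all add: power2_eq_square power3_eq_cube mult.assoc)
  show "784 \<le> t\<^sup>2" using 1 assms by linarith
qed

lemma a_bounds:
  assumes "28 \<le> t"
  shows "0 < a1 t" "a1 t < a2 t" "a2 t < a3 t" "a3 t < a4 t"
    "a3 t \<le> 7 * t\<^sup>2" "a4 t \<le> t ^ 3" "t ^ 3 \<le> 2 * a4 t"
  using cubic_bounds[OF assms] assms unfolding a1_def a2_def a3_def a4_def by (simp_all add: algebra_simps)

section \<open>Growth of the two Frobenius bounds\<close>

text \<open>From above, one member of the minimum suffices: the first is governed by the square root
  of a product of four factors of order \<open>t\<^sup>2\<close>. As the absolute value counts, all
  four must also be bounded below.\<close>

lemma known_bound_bigo: "known_bound \<in> O(\<lambda>t. real_of_int t ^ 4)"
proof (rule bigoI[of _ 100])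
  show "\<forall>\<^sub>F t in at_top. norm (known_bound t) \<le> 100 * norm (real_of_int t ^ 4)"
    using eventually_ge_at_top[of 28]
  proof eventually_elim
    case (elim t)
    define R where "R = real_of_int t"
    define b1 b2 b3 b4 where b: "b1 = real_of_int (a1 t)" "b2 = real_of_int (a2 t)"
      "b3 = real_of_int (a3 t)" "b4 = real_of_int (a4 t)"
    have R: "R \<ge> 28" using elim by (simp add: R_def)
    have "real_of_int 1 \<le> b1" "real_of_int (a3 t) \<le> real_of_int (7 * t\<^sup>2)"
      "real_of_int (a4 t) \<le> real_of_int (t ^ 3)"
      using a_bounds[OF elim] unfolding b of_int_le_iff by linarith+
    then have bounds: "1 \<le> b1" "b1 < b2" "b2 < b3" "b3 < b4" "b3 \<le> 7 * R\<^sup>2" "b4 \<le> R ^ 3"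
      using a_bounds[OF elim] by (simp_all add: b R_def)
    have R4: "R ^ 3 \<le> R ^ 4" "R\<^sup>2 \<le> R ^ 4" "1 \<le> R ^ 4"
      using R by (auto intro: power_increasing)
    define q where "q = sqrt (b1 * b2 * b3 * (b1 + b2 + b3))"
    define X1 where "X1 = 1/2 * (q - b1 - b2 - b3)"
    define X2 where "X2 = 2 * b4 * real_of_int \<lfloor>b1 / 4\<rfloor> - b1"
    define X3 where "X3 = 2 * b3 * real_of_int \<lfloor>b4 / 4\<rfloor> - b4"
    define X4 where "X4 = real_of_int \<lfloor>(b2 - 1) * (b4 - 2) / 2\<rfloor> - 1"
    have kb: "known_bound t = Min {X1, X2, X3, X4}"
      unfolding known_bound_def Let_def q_def X1_def X2_def X3_def X4_def b ..
    have "b1 * b2 * b3 * (b1 + b2 + b3) \<le> (7 * R\<^sup>2) * (7 * R\<^sup>2) * (7 * R\<^sup>2) * (21 * R\<^sup>2)"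
      using bounds by (intro mult_mono) auto
    also have "\<dots> = 7203 * R ^ 8" by (simp add: eval_nat_numeral)
    \<comment> \<open>The constant is rounded up to a perfect square.\<close>
    also have "\<dots> \<le> 10000 * R ^ 8" by simp
    also have "\<dots> = (100 * R ^ 4)\<^sup>2" by (simp add: power_mult_distrib flip: power_mult)
    finally have "q \<le> 100 * R ^ 4"
      unfolding q_def by (intro real_le_lsqrt) auto
    moreover have "0 \<le> q"
      unfolding q_def using bounds by simp
    ultimately have X1: "X1 \<le> 100 * R ^ 4" "- (100 * R ^ 4) \<le> X1"
      unfolding X1_def using bounds R4 by (simp_all add: field_simps)
    have "0 \<le> b4 * \<lfloor>b1 / 4\<rfloor>" "0 \<le> b3 * \<lfloor>b4 / 4\<rfloor>" "0 \<le> \<lfloor>(b2 - 1) * (b4 - 2) / 2\<rfloor>"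
      using bounds a_bounds[OF elim] by (auto simp: b)
    then have "- (100 * R ^ 4) \<le> X2" "- (100 * R ^ 4) \<le> X3" "- (100 * R ^ 4) \<le> X4"
      unfolding X2_def X3_def X4_def using bounds R4 by linarith+
    then have "\<bar>known_bound t\<bar> \<le> 100 * R ^ 4"
      unfolding kb using X1 by (simp add: abs_le_iff min_def)
    then show ?case by (simp add: R_def)
  qed
qed

text \<open>The numerator has order \<open>t ^ 5\<close>. The norm of the vector has order
  \<open>t ^ 3\<close>, so the cube root of its square has order \<open>t\<^sup>2\<close>, which
  leaves \<open>t ^ 3\<close>.\<close>

lemma esm_bound_bigo: "esm_bound \<in> O(\<lambda>t. real_of_int t ^ 3)"
proof (rule bigoI[of _ 1000])
  show "\<forall>\<^sub>F t in at_top. norm (esm_bound t) \<le> 1000 * norm (real_of_int t ^ 3)"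
    using eventually_ge_at_top[of 28]
  proof eventually_elim
    case (elim t)
    define R where "R = real_of_int t"
    define b1 b2 b3 b4 where b: "b1 = real_of_int (a1 t)" "b2 = real_of_int (a2 t)"
      "b3 = real_of_int (a3 t)" "b4 = real_of_int (a4 t)"
    have R: "R \<ge> 28" using elim by (simp add: R_def)
    have "real_of_int (a3 t) \<le> real_of_int (7 * t\<^sup>2)" "real_of_int (a4 t) \<le> real_of_int (t ^ 3)"
      "real_of_int (t ^ 3) \<le> real_of_int (2 * a4 t)"
      using a_bounds[OF elim] unfolding of_int_le_iff by linarith+
    then have bounds: "0 < b1" "b1 < b2" "b2 < b3" "b3 < b4" "b3 \<le> 7 * R\<^sup>2" "b4 \<le> R ^ 3" "R ^ 3 \<le> 2 * b4"
      using a_bounds[OF elim] by (simp_all add: b R_def)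
    define N where "N = b1\<^sup>2 + b2\<^sup>2 + b3\<^sup>2 + b4\<^sup>2"
    define D where "D = (N * (4 * pi / 3)) powr (1 / 3)"
    define Q where "Q = b1 * sqrt (N - b1\<^sup>2) + b2 * sqrt (N - b2\<^sup>2) + b3 * sqrt (N - b3\<^sup>2) + b4 * sqrt (N - b4\<^sup>2)"
    have esm: "esm_bound t = real_of_int \<lfloor>9 * Q / D + 1\<rfloor>"
      unfolding esm_bound_def norm_vec4 real_vec_def
      by (simp add: sum_4 avec_def b Q_def D_def N_def)
    have sq: "b1\<^sup>2 \<le> 49 * R ^ 4" "b2\<^sup>2 \<le> 49 * R ^ 4" "b3\<^sup>2 \<le> 49 * R ^ 4"
      using bounds power_mono[of _ "7 * R\<^sup>2" 2] by (auto simp: power_mult_distrib simp flip: power_mult)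
    have sq4: "b4\<^sup>2 \<le> R ^ 6" "R ^ 6 \<le> 4 * b4\<^sup>2"
      using power_mono[of b4 "R ^ 3" 2] power_mono[of "R ^ 3" "2 * b4" 2] bounds R
      by (auto simp: power_mult_distrib simp flip: power_mult)
    have "784 * R ^ 4 \<le> R\<^sup>2 * R ^ 4"
      using cubic_bounds(3)[OF R] by (intro mult_right_mono) auto
    then have "784 * R ^ 4 \<le> R ^ 6" by (simp flip: power_add)
    then have N: "N \<le> (2 * R ^ 3)\<^sup>2"
      using sq sq4 zero_le_power[of R 6] R unfolding N_def
      by (simp add: power_mult_distrib flip: power_mult)
    have rt: "sqrt (N - b1\<^sup>2) \<le> 2 * R ^ 3" "sqrt (N - b2\<^sup>2) \<le> 2 * R ^ 3" "sqrt (N - b3\<^sup>2) \<le> 2 * R ^ 3"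
      using N R by (auto intro!: real_le_lsqrt intro: order_trans[of _ N])
    \<comment> \<open>The dominant square cancels; the other three sum to at most
      \<open>147 * R ^ 4\<close>, rounded up so that the constant is
      \<open>13\<^sup>2\<close>.\<close>
    have "N - b4\<^sup>2 \<le> 169 * R ^ 4"
      using sq zero_le_power[of R 4] R unfolding N_def by linarith
    then have "N - b4\<^sup>2 \<le> (13 * R\<^sup>2)\<^sup>2"
      by (simp add: power_mult_distrib flip: power_mult)
    then have rt4: "sqrt (N - b4\<^sup>2) \<le> 13 * R\<^sup>2" by (intro real_le_lsqrt) auto
    have "Q \<le> 7 * R\<^sup>2 * (2 * R ^ 3) + 7 * R\<^sup>2 * (2 * R ^ 3) + 7 * R\<^sup>2 * (2 * R ^ 3) + R ^ 3 * (13 * R\<^sup>2)"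
      unfolding Q_def using bounds rt rt4 R
      by (intro add_mono mult_mono) (auto simp: N_def)
    also have "\<dots> = 55 * R ^ 5" by (simp add: eval_nat_numeral)
    finally have Q: "Q \<le> 55 * R ^ 5" .
    have Q0: "0 \<le> Q" unfolding Q_def using bounds
      by (intro add_nonneg_nonneg mult_nonneg_nonneg) (auto simp: N_def)
    \<comment> \<open>Since \<open>N\<close> is at least \<open>b4\<^sup>2\<close>, hence at least
      \<open>R ^ 6 / 4\<close>, it exceeds the cube of \<open>R\<^sup>2 / 2\<close>; writing the
      latter as a cube root reduces the claim to monotonicity.\<close>
    have "R\<^sup>2 / 2 = ((R\<^sup>2 / 2) ^ 3) powr (1 / 3)"
      using R by (simp add: powr_powr del: power_divide flip: powr_numeral)
    also have "\<dots> \<le> D"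
      unfolding D_def
    proof (rule powr_mono2)
      have "(R\<^sup>2 / 2) ^ 3 = R ^ 6 / 8" by (simp add: power_divide flip: power_mult)
      also have "\<dots> \<le> N"
        using sq4(2) zero_le_power2[of b1] zero_le_power2[of b2] zero_le_power2[of b3]
          zero_le_power2[of b4] unfolding N_def by linarith
      also have "\<dots> \<le> N * (4 * pi / 3)"
        using mult_left_mono[of 1 "4 * pi / 3" N] pi_gt3 by (simp add: N_def)
      finally show "(R\<^sup>2 / 2) ^ 3 \<le> N * (4 * pi / 3)" .
    qed auto
    finally have D: "R\<^sup>2 / 2 \<le> D" .
    then have D0: "0 < D" using R by (smt (verit) zero_less_power divide_pos_pos)
    have "9 * Q / D \<le> 9 * (55 * R ^ 5) / (R\<^sup>2 / 2)"
      using Q Q0 D R by (intro frac_le) auto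
    also have "\<dots> = 990 * R ^ 3" using R by (simp add: field_simps eval_nat_numeral)
    finally have "9 * Q / D \<le> 990 * R ^ 3" .
    moreover have "0 \<le> 9 * Q / D" using Q0 D0 by simp
    moreover have "1 \<le> R ^ 3" using R by simp
    ultimately have "\<bar>esm_bound t\<bar> \<le> 1000 * R ^ 3"
      unfolding esm by linarith
    then show ?case by (simp add: R_def)
  qed
qed

theorem theorem4p2:
  shows "let S = {t :: int. t > 0 \<and>
                    (0 < a1 t \<and> a1 t < a2 t \<and> a2 t < a3 t \<and> a3 t < a4 t) \<and>
                    Gcd {a1 t, a2 t, a3 t, a4 t} = 1 \<and>
                    ESM3 (orth_lattice (avec t))}
         in infinite S
          \<and> known_bound \<in> O[inf at_top (principal S)](\<lambda>t. real_of_int t ^ 4)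
          \<and> esm_bound \<in> O[inf at_top (principal S)](\<lambda>t. real_of_int t ^ 3)
          \<and> (\<forall>s::int. s \<ge> 2 \<longrightarrow> 13 * s + 2 \<in> S)
          \<and> (\<lambda>s::int. known_bound (13 * s + 2)) \<in> O(\<lambda>s. real_of_int (13 * s + 2) ^ 4)
          \<and> (\<lambda>s::int. esm_bound (13 * s + 2)) \<in> O(\<lambda>s. real_of_int (13 * s + 2) ^ 3)"
proof -
  define S where "S = {t :: int. t > 0 \<and>
                    (0 < a1 t \<and> a1 t < a2 t \<and> a2 t < a3 t \<and> a3 t < a4 t) \<and>
                    Gcd {a1 t, a2 t, a3 t, a4 t} = 1 \<and>
                    ESM3 (orth_lattice (avec t))}"
  have mem: "13 * s + 2 \<in> S" if "s \<ge> 2" for s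
  proof -
    let ?t = "13 * s + 2"
    have t: "28 \<le> ?t" using that by simp
    have "Gcd {a1 ?t, a2 ?t, a3 ?t, a4 ?t} dvd gcd (a2 ?t) (a3 ?t)"
      by (intro gcd_greatest Gcd_dvd) auto
    then have "Gcd {a1 ?t, a2 ?t, a3 ?t, a4 ?t} = 1"
      using coprime_a2_a3[of s] by (metis Gcd_int_greater_eq_0 coprime_imp_gcd_eq_1 zdvd1_eq abs_of_nonneg)
    then show ?thesis
      using a_bounds[OF t] ESM3_orth_lattice[OF coprime_a2_a3 t] t by (simp add: S_def)
  qed
  have "infinite ((\<lambda>s::int. 13 * s + 2) ` {2..})"
    by (simp add: finite_image_iff inj_on_def infinite_Ici)
  moreover have "(\<lambda>s::int. 13 * s + 2) ` {2..} \<subseteq> S" using mem by auto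
  ultimately have inf: "infinite S" using finite_subset by blast
  have lim: "filterlim (\<lambda>s::int. 13 * s + 2) at_top at_top"
    unfolding filterlim_at_top
  proof
    fix Z :: int
    show "\<forall>\<^sub>F s in at_top. Z \<le> 13 * s + 2"
      using eventually_ge_at_top[of "max Z 0"] by eventually_elim auto
  qed
  show ?thesis
    \<comment> \<open>Both growth bounds hold for all large \<open>t\<close>, so they pass to the
      finer filter restricted to \<open>S\<close> and, by composition with \<open>lim\<close>, to
      the progression.\<close>
    unfolding Let_def S_def[symmetric]
    using inf mem
      landau_o.big.filter_mono[OF inf_le1 known_bound_bigo]
      landau_o.big.filter_mono[OF inf_le1 esm_bound_bigo]
      landau_o.big.compose[OF known_bound_bigo lim]
      landau_o.big.compose[OF esm_bound_bigo lim]
    by blast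
qed

end
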